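(* Let $m_1,m_2,\ldots$ be nonnegative integers, let $n\ge 1$, and consider one of the three types of combinatorial structure (assemblies, multisets, selections) determined by $(m_i)$. Let $x>0$, with $x<1$ in the case of multisets. Let $I=\{\alpha=(i,j):1\le i\le n,\ 1\le j\le m_i\}$ with weights $w(\alpha)=i$ for $\alpha=(i,j)$, let $\mathbf{D}(n)=(D_\alpha)_{\alpha\in I}$ be the refined component counting process of a uniformly chosen structure of weight $n$, let $\mathbf{Y}(n)=(Y_\alpha)_{\alpha\in I}$ be the corresponding refined independent process with parameter $x$, and let $T=\sum_{\alpha\in I}w(\alpha)Y_\alpha$; assume $\mathbb{P}(T=n)>0$. For $K\subset I$, let $\mathbf{D}_K=(D_\alpha)_{\alpha\in K}$, $\mathbf{Y}_K=(Y_\alpha)_{\alpha\in K}$ and $R'_K=\sum_{\alpha\in K}w(\alpha)Y_\alpha$. Then for every $K\subset I$ $$d_{TV}(\mathbf{D}_K,\mathbf{Y}_K)=d_{TV}\bigl((R'_K\mid T=n),R'_K\bigr).$$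
   Context: Let $m_1,m_2,\ldots$ be nonnegative integers. An assembly on $[n]=\{1,\ldots,n\}$ (weight $n$) is a partition of the set $[n]$ into nonempty blocks together with, for each block of size $i$, a choice of one of $m_i$ possible structures on that block, labelled $1,\ldots,m_i$. For multisets and selections, there are $m_i$ distinct objects of weight $i$, labelled $1,\ldots,m_i$, for each $i\ge 1$; a multiset of weight $n$ is an unordered collection of such objects, repetitions allowed, of total weight $n$; a selection of weight $n$ is an unordered collection of distinct such objects of total weight $n$. In each case the blocks (or the objects in the collection) are the components, and $D_{ij}=D_{ij}(n)$ is the number of components of size (weight) $i$ having the $j$-th structure (being the $j$-th object of weight $i$), when a structure of weight $n$ is chosen uniformly at random among all structures of weight $n$ of the given type. The random variables $Y_{ij}$ are mutually independent with, for $1\le j\le m_i$: for assemblies, $Y_{ij}$ Poisson with mean $x^i/i!$; for multisets ($0<x<1$), $\mathbb{P}(Y_{ij}=k)=(1-x^i)x^{ik}$, $k=0,1,\ldots$; for selections, $\mathbb{P}(Y_{ij}=0)=1/(1+x^i)$ and $\mathbb{P}(Y_{ij}=1)=x^i/(1+x^i)$. For random elements $X,Y$ of a countable set $S$, $d_{TV}(X,Y)=\frac12\sum_{s\in S}|\mathbb{P}(X=s)-\mathbb{P}(Y=s)|$, and $(R\mid T=n)$ denotes the conditional distribution of $R$ given $\{T=n\}$. *)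

theory Defs
  imports "HOL-Probability.Probability"
begin

datatype comb_class = Assemblies | Multisets | Selections

text \<open>
  An assembly is a set partition together with a choice of a label for each of its blocks.
  A multiset or selection consists of objects \<open>(i, j)\<close>, the \<open>j\<close>-th object of weight \<open>i\<close>.
\<close>

datatype comb_object =
    Assembly "nat set set" "nat set \<Rightarrow> nat"
  | Multiset "(nat \<times> nat) multiset"
  | Selection "(nat \<times> nat) set"

definition objects :: "(nat \<Rightarrow> nat) \<Rightarrow> (nat \<times> nat) set" where
  "objects m = {(i, j). 1 \<le> i \<and> 1 \<le> j \<and> j \<le> m i}"

fun comb_objects :: "comb_class \<Rightarrow> (nat \<Rightarrow> nat) \<Rightarrow> nat \<Rightarrow> comb_object set" where
  "comb_objects Assemblies m n =
     {Assembly P f | P f. partition_on {1..n} P \<and> f \<in> (\<Pi>\<^sub>E B\<in>P. {1..m (card B)})}"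
| "comb_objects Multisets m n =
     {Multiset A | A. set_mset A \<subseteq> objects m \<and> (\<Sum>\<alpha>\<in>#A. fst \<alpha>) = n}"
| "comb_objects Selections m n =
     {Selection A | A. finite A \<and> A \<subseteq> objects m \<and> (\<Sum>\<alpha>\<in>A. fst \<alpha>) = n}"

fun component_count :: "comb_object \<Rightarrow> nat \<times> nat \<Rightarrow> nat" where
  "component_count (Assembly P f) (i, j) = card {B \<in> P. card B = i \<and> f B = j}"
| "component_count (Multiset A) (i, j) = count A (i, j)"
| "component_count (Selection A) (i, j) = of_bool ((i, j) \<in> A)"

definition refined_index :: "(nat \<Rightarrow> nat) \<Rightarrow> nat \<Rightarrow> (nat \<times> nat) set" where
  "refined_index m n = {(i, j). 1 \<le> i \<and> i \<le> n \<and> 1 \<le> j \<and> j \<le> m i}"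

text \<open>
  The library's \<open>geometric_pmf p\<close> has mass \<open>(1 - p) ^ k * p\<close> at \<open>k = 0, 1, \<dots>\<close>, so the second
  equation gives mass \<open>(1 - x ^ i) * x ^ (i * k)\<close> at \<open>k\<close>.
\<close>

fun component_law :: "comb_class \<Rightarrow> real \<Rightarrow> nat \<Rightarrow> nat pmf" where
  "component_law Assemblies x i = poisson_pmf (x ^ i / fact i)"
| "component_law Multisets x i = geometric_pmf (1 - x ^ i)"
| "component_law Selections x i = map_pmf of_bool (bernoulli_pmf (x ^ i / (1 + x ^ i)))"

definition weighted_sum :: "(nat \<times> nat \<Rightarrow> 'a \<Rightarrow> nat) \<Rightarrow> (nat \<times> nat) set \<Rightarrow> 'a \<Rightarrow> nat" where
  "weighted_sum Y K \<omega> = (\<Sum>\<alpha>\<in>K. fst \<alpha> * Y \<alpha> \<omega>)"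

text \<open>
  Total variation distance between random elements \<open>X\<close> on \<open>M\<close> and \<open>Y\<close> on \<open>N\<close> that take values
  in a countable set. The sum ranges over the whole type; values outside that countable set
  contribute \<open>0\<close>.
\<close>

definition d_TV :: "'a measure \<Rightarrow> ('a \<Rightarrow> 's) \<Rightarrow> 'b measure \<Rightarrow> ('b \<Rightarrow> 's) \<Rightarrow> real" where
  "d_TV M X N Y =
     1 / 2 * (\<Sum>\<^sub>\<infinity>s. \<bar>\<P>(\<omega> in M. X \<omega> = s) - \<P>(\<omega> in N. Y \<omega> = s)\<bar>)"

text \<open>
  The library's \<open>uniform_measure M A\<close> is \<open>M\<close> conditioned on the event \<open>A\<close>: it assigns
  \<open>emeasure M (A \<inter> B) / emeasure M A\<close> to \<open>B\<close>.
\<close>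

abbreviation conditioned :: "'a measure \<Rightarrow> ('a \<Rightarrow> bool) \<Rightarrow> 'a measure" where
  "conditioned M Q \<equiv> uniform_measure M {\<omega> \<in> space M. Q \<omega>}"

end

theory Submission imports Defs
begin

text \<open>
  The number of structures of weight \<open>n\<close> with component counts \<open>f\<close> is proportional to
  \<open>P(Y = f)\<close> as \<open>f\<close> ranges over the counts of weight \<open>n\<close>, so \<open>D\<close> has the law of \<open>Y\<close>
  conditioned on \<open>T = n\<close>. By independence of the coordinates inside and outside \<open>K\<close>, the density of
  the conditioned \<open>Y\<^sub>K\<close> with respect to \<open>Y\<^sub>K\<close> is a function \<open>g\<close> of the weighted sum over
  \<open>K\<close> alone. Hence both total variation distances equal half the expectation of
  \<open>\<bar>g - 1\<bar>\<close>, taken once over \<open>Y\<^sub>K\<close> and once over its weighted sum.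
\<close>

section \<open>Total variation and sufficient statistics\<close>

text \<open>Both mass functions sum to 1, so summing the proportionality over all \<open>u\<close>
  forces \<open>c = 1\<close>. Normalising constants therefore never have to be computed.\<close>

lemma pmf_proportional_eq:
  assumes "\<And>u. pmf q u = c * pmf p u"
  shows "q = p"
proof -
  have "1 = (\<Sum>\<^sub>au. c * pmf p u)"
    using infsetsum_pmf_eq_1[of q UNIV] assms by simp
  also have "\<dots> = c"
    using infsetsum_pmf_eq_1[of p UNIV] by (subst infsetsum_cmult_right) (auto intro: pmf_abs_summable)
  finally show ?thesis
    using assms by (intro pmf_eqI) simp
qed

text \<open>Passes from the infinite sum in \<open>d_TV\<close> to the one in which pmf expectations
  are expressed; absolute summability of mass functions makes the two agree.\<close>

lemma infsum_abs_pmf_diff: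
  "(\<Sum>\<^sub>\<infinity>u. \<bar>pmf q u - pmf p u\<bar>) = (\<Sum>\<^sub>au. \<bar>pmf q u - pmf p u\<bar>)"
proof -
  have "Infinite_Set_Sum.abs_summable_on (\<lambda>u. pmf q u - pmf p u) UNIV"
    by (intro abs_summable_on_diff pmf_abs_summable)
  then have "Infinite_Set_Sum.abs_summable_on (\<lambda>u. \<bar>pmf q u - pmf p u\<bar>) UNIV"
    using abs_summable_on_norm_iff[of "\<lambda>u. pmf q u - pmf p u"] by simp
  then show ?thesis
    by (simp add: infsetsum_infsum)
qed

text \<open>A general map \<open>t\<close> can only shrink the distance. Here nothing is lost:
  \<open>g\<close> is constant on each fibre of \<open>t\<close>, so it comes out of the fibre sums
  and is again the density between the image laws.\<close>

lemma infsum_abs_pmf_diff_sufficient: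
  assumes "\<And>u. pmf q u = pmf p u * g (t u)"
  shows "(\<Sum>\<^sub>\<infinity>u. \<bar>pmf q u - pmf p u\<bar>) =
    (\<Sum>\<^sub>\<infinity>r. \<bar>pmf (map_pmf t q) r - pmf (map_pmf t p) r\<bar>)"
proof -
  have map: "pmf (map_pmf t q) r = pmf (map_pmf t p) r * g r" for r
  proof -
    have "pmf (map_pmf t q) r = (\<Sum>\<^sub>au\<in>t -` {r}. pmf p u * g (t u))"
      by (simp add: pmf_map measure_pmf_conv_infsetsum assms)
    also have "\<dots> = (\<Sum>\<^sub>au\<in>t -` {r}. pmf p u * g r)"
      by (intro infsetsum_cong) auto
    also have "\<dots> = pmf (map_pmf t p) r * g r"
      by (simp add: pmf_map measure_pmf_conv_infsetsum infsetsum_cmult_left pmf_abs_summable)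
    finally show ?thesis .
  qed
  \<comment> \<open>Turns a difference of masses into mass times \<open>\<bar>g - 1\<bar>\<close>,
    the form of an expectation.\<close>
  have dev: "\<bar>a * b - a\<bar> = a * \<bar>b - 1\<bar>" if "a \<ge> 0" for a b :: real
    using that abs_mult[of a "b - 1"] by (simp add: algebra_simps)
  have "(\<Sum>\<^sub>au. \<bar>pmf q u - pmf p u\<bar>) = measure_pmf.expectation p (\<lambda>u. \<bar>g (t u) - 1\<bar>)"
    by (simp add: pmf_expectation_eq_infsetsum assms dev)
  also have "\<dots> = measure_pmf.expectation (map_pmf t p) (\<lambda>r. \<bar>g r - 1\<bar>)"
    by simp
  also have "\<dots> = (\<Sum>\<^sub>ar. \<bar>pmf (map_pmf t q) r - pmf (map_pmf t p) r\<bar>)"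
    by (simp only: pmf_expectation_eq_infsetsum map dev pmf_nonneg)
  finally show ?thesis
    by (simp add: infsum_abs_pmf_diff)
qed

section \<open>Conditioning on the total weight\<close>

abbreviation weight :: "(nat \<times> nat) set \<Rightarrow> (nat \<times> nat \<Rightarrow> nat) \<Rightarrow> nat" where
  "weight K f \<equiv> \<Sum>\<alpha>\<in>K. fst \<alpha> * f \<alpha>"

text \<open>Once the coordinates in \<open>K\<close> are fixed to \<open>u\<close>, the event
  \<open>A\<close> only asks the independent coordinates in \<open>I - K\<close> to supply the
  missing weight. The probability of that depends on \<open>weight K u\<close> alone; divided by the
  probability of \<open>A\<close> it is \<open>g\<close>.\<close>

lemma pmf_restrict_cond_weight:
  fixes law :: "nat \<times> nat \<Rightarrow> nat pmf" and n :: nat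
  assumes "finite I" "K \<subseteq> I"
  defines "p \<equiv> Pi_pmf I undefined law"
  defines "A \<equiv> {f. weight I f = n}"
  assumes "set_pmf p \<inter> A \<noteq> {}"
  shows "\<exists>g. \<forall>u. pmf (map_pmf (\<lambda>f. restrict f K) (cond_pmf p A)) u =
    pmf (map_pmf (\<lambda>f. restrict f K) p) u * g (weight K u)"
proof -
  define pK where "pK = Pi_pmf K undefined law"
  define pL where "pL = Pi_pmf (I - K) undefined law"
  \<comment> \<open>The additive form makes \<open>G k\<close> empty for \<open>k > n\<close>, which
    truncated subtraction would not.\<close>
  define G where "G k = {v. k + weight (I - K) v = n}" for k
  have fin: "finite K" "finite (I - K)" and I: "K \<union> (I - K) = I"
    using assms(1,2) by (auto intro: finite_subset)
  define h where "h f g = (\<lambda>\<alpha>. if \<alpha> \<in> K then f \<alpha> else g \<alpha> :: nat)" for f g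
  have p: "p = map_pmf (\<lambda>(f, g). h f g) (pair_pmf pK pL)"
    using Pi_pmf_union[OF fin, of undefined law] unfolding I p_def pK_def pL_def h_def by simp
  have res: "restrict (h f g) K = restrict f K" for f g
    by (auto simp: h_def)
  have w: "weight I (h f g) = weight K f + weight (I - K) g" for f g
  proof -
    have "weight I (h f g) = weight (I - K) (h f g) + weight K (h f g)"
      using assms(1,2) by (intro sum.subset_diff)
    moreover have "weight (I - K) (h f g) = weight (I - K) g" "weight K (h f g) = weight K f"
      by (auto intro!: sum.cong simp: h_def)
    ultimately show ?thesis
      by simp
  qed
  \<comment> \<open>The default \<open>undefined\<close> of \<open>Pi_pmf\<close> is also the value
    of \<open>restrict\<close> outside \<open>K\<close>, so restricting yields exactly the
    marginal.\<close>
  have marg: "map_pmf (\<lambda>f. restrict f K) p = pK"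
    unfolding p_def pK_def restrict_def using Pi_pmf_subset[OF assms(1,2), of undefined law] by simp
  have extK: "set_pmf pK \<subseteq> extensional K"
    using set_Pi_pmf_subset[OF fin(1), of undefined law] by (auto simp: pK_def extensional_def)
  have joint: "measure p (A \<inter> (\<lambda>f. restrict f K) -` {u}) = pmf pK u * measure pL (G (weight K u))" for u
  proof -
    have "measure p (A \<inter> (\<lambda>f. restrict f K) -` {u}) =
      measure (pair_pmf pK pL) ({(f, g). restrict f K = u \<and> weight K f + weight (I - K) g = n})"
      unfolding p A_def measure_map_pmf
      by (rule arg_cong[where f = "measure _"]) (auto simp: w res)
    \<comment> \<open>The event is a rectangle only up to null sets: \<open>restrict f K = u\<close>
      means \<open>f = u\<close> just for extensional \<open>f\<close>, and these carry all the mass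
      of \<open>pK\<close>. Intersecting with \<open>set_pmf pL\<close> makes the second side
      countable for the product formula.\<close>
    also have "\<dots> = measure (pair_pmf pK pL) ({u} \<times> (G (weight K u) \<inter> set_pmf pL))"
    proof (intro measure_pmf.finite_measure_eq_AE)
      show "AE x in measure_pmf (pair_pmf pK pL).
        (x \<in> {(f, g). restrict f K = u \<and> weight K f + weight (I - K) g = n}) =
        (x \<in> {u} \<times> (G (weight K u) \<inter> set_pmf pL))"
        using extK by (auto simp: AE_measure_pmf_iff G_def extensional_restrict dest!: subsetD)
    qed auto
    also have "\<dots> = pmf pK u * measure pL (G (weight K u) \<inter> set_pmf pL)"
      by (subst measure_pmf_prob_product) (auto simp: measure_pmf_single)
    finally show ?thesis
      by (simp add: measure_Int_set_pmf)
  qed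
  have "pmf (map_pmf (\<lambda>f. restrict f K) (cond_pmf p A)) u =
    pmf pK u * (measure pL (G (weight K u)) / measure p A)" for u
  proof -
    have "measure p A \<noteq> 0"
      using assms(5) by (simp add: measure_measure_pmf_not_zero)
    then show ?thesis
      using joint[of u]
      by (simp add: pmf_map cond_pmf.rep_eq[OF assms(5)] measure_pmf.emeasure_eq_measure)
  qed
  then show ?thesis
    unfolding marg by (intro exI[of _ "\<lambda>k. measure pL (G k) / measure p A"]) simp
qed

text \<open>The image of the uniform law on \<open>S\<close> gives each point a mass proportional to
  its number of preimages, and so does \<open>p\<close> on \<open>A\<close>. Both laws vanish off
  \<open>A\<close>, hence they agree after normalisation.\<close>

lemma cond_pmf_eq_map_pmf_of_set:
  fixes p :: "'b pmf" and c :: real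
  assumes "finite S" and "set_pmf p \<inter> A \<noteq> {}" and "\<And>s. s \<in> S \<Longrightarrow> \<phi> s \<in> A"
    and "\<And>f. f \<in> A \<Longrightarrow> pmf p f = c * card {s \<in> S. \<phi> s = f}"
  shows "cond_pmf p A = map_pmf \<phi> (pmf_of_set S)"
proof -
  obtain f where f: "f \<in> set_pmf p" "f \<in> A"
    using assms(2) by auto
  have "pmf p f \<noteq> 0"
    using f(1) by (simp add: set_pmf_iff)
  \<comment> \<open>A point of positive mass in \<open>A\<close> must have a preimage, so
    \<open>S\<close> is nonempty and \<open>pmf_of_set S\<close> is meaningful.\<close>
  then have "{s \<in> S. \<phi> s = f} \<noteq> {}"
    using assms(4)[OF f(2)] by (metis card.empty mult_zero_right of_nat_0)
  then have ne: "S \<noteq> {}"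
    by blast
  show "cond_pmf p A = map_pmf \<phi> (pmf_of_set S)"
  proof (rule pmf_proportional_eq)
    fix f
    have "pmf (map_pmf \<phi> (pmf_of_set S)) f = card {s \<in> S. \<phi> s = f} / card S"
      using ne assms(1)
      by (simp add: pmf_map measure_pmf_of_set) (rule arg_cong[where f = card], auto)
    moreover have "{s \<in> S. \<phi> s = f} = {}" if "f \<notin> A"
      using assms(3) that by auto
    ultimately show "pmf (cond_pmf p A) f =
      c * real (card S) / measure p A * pmf (map_pmf \<phi> (pmf_of_set S)) f"
      using ne assms(1) by (cases "f \<in> A") (auto simp: pmf_cond[OF assms(2)] assms(4))
  qed
qed

text \<open>The bridge from random variables on \<open>M\<close> to pmfs. The restricted vector
  lives in the countable set \<open>?E\<close>, so its law is determined by point masses, and these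
  factor by independence.\<close>

lemma (in prob_space) distr_restrict_eq_Pi_pmf:
  fixes Y :: "'i \<Rightarrow> 'a \<Rightarrow> 'b :: countable"
  assumes "finite I" and indep: "indep_vars (\<lambda>_. count_space UNIV) Y I"
    and law: "\<And>\<alpha>. \<alpha> \<in> I \<Longrightarrow> distr M (count_space UNIV) (Y \<alpha>) = measure_pmf (p \<alpha>)"
  shows "(\<lambda>\<omega>. \<lambda>\<alpha>\<in>I. Y \<alpha> \<omega>) \<in> measurable M (count_space UNIV)"
    and "distr M (count_space UNIV) (\<lambda>\<omega>. \<lambda>\<alpha>\<in>I. Y \<alpha> \<omega>) = measure_pmf (Pi_pmf I undefined p)"
proof -
  let ?Y = "\<lambda>\<omega>. \<lambda>\<alpha>\<in>I. Y \<alpha> \<omega>" and ?E = "(PiE I (\<lambda>_. UNIV) :: ('i \<Rightarrow> 'b) set)"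
  have meas: "Y \<alpha> \<in> measurable M (count_space UNIV)" if "\<alpha> \<in> I" for \<alpha>
    using indep that by (auto simp: indep_vars_def)
  have count: "countable ?E"
    using assms(1) by (intro countable_PiE) auto
  have vimage: "?Y -` {f} \<inter> space M = {\<omega> \<in> space M. \<forall>\<alpha>\<in>I. Y \<alpha> \<omega> = f \<alpha>}" if "f \<in> ?E" for f
    using that by (auto simp: fun_eq_iff restrict_def PiE_def extensional_def)
  show Y: "?Y \<in> measurable M (count_space UNIV)"
  proof -
    have "?Y -` {f} \<inter> space M \<in> sets M" if "f \<in> ?E" for f
    proof -
      have "{\<omega> \<in> space M. \<forall>\<alpha>\<in>I. Y \<alpha> \<omega> = f \<alpha>} \<in> sets M"
        using assms(1)
        by (intro sets.sets_Collect_finite_All' sets.sets_Collect_finite_All)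
           (auto intro!: measurable_sets_Collect[OF meas])
      then show ?thesis
        using vimage[OF that] by simp
    qed
    \<comment> \<open>Checking singletons suffices for the countable target \<open>?E\<close>; the
      full function type may be uncountable, so measurability is carried over from there.\<close>
    then have "?Y \<in> measurable M (count_space ?E)"
      using count by (subst measurable_count_space_eq_countable) auto
    then show ?thesis
      by (rule measurable_compose) auto
  qed
  show "distr M (count_space UNIV) ?Y = measure_pmf (Pi_pmf I undefined p)"
  proof (rule measure_eqI_countable_AE)
    show "AE x in distr M (count_space UNIV) ?Y. x \<in> ?E"
      using Y by (subst AE_distr_iff) auto
    show "AE x in measure_pmf (Pi_pmf I undefined p). x \<in> ?E"
      using set_Pi_pmf_subset[OF assms(1), of undefined p]
      by (auto simp: AE_measure_pmf_iff PiE_def extensional_def)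
    fix f assume f: "f \<in> ?E"
    have "prob {\<omega> \<in> space M. \<forall>\<alpha>\<in>I. Y \<alpha> \<omega> = f \<alpha>} = (\<Prod>\<alpha>\<in>I. pmf (p \<alpha>) (f \<alpha>))"
    \<comment> \<open>The empty index set is separate because an intersection over it is
      \<open>UNIV\<close>, not \<open>space M\<close>.\<close>
    proof (cases "I = {}")
      case True
      then show ?thesis
        by (simp add: prob_space)
    next
      case False
      have "prob (\<Inter>\<alpha>\<in>I. Y \<alpha> -` {f \<alpha>} \<inter> space M) = (\<Prod>\<alpha>\<in>I. prob (Y \<alpha> -` {f \<alpha>} \<inter> space M))"
        using False assms(1) by (intro indep_varsD[OF indep]) auto
      also have "(\<Inter>\<alpha>\<in>I. Y \<alpha> -` {f \<alpha>} \<inter> space M) = {\<omega> \<in> space M. \<forall>\<alpha>\<in>I. Y \<alpha> \<omega> = f \<alpha>}"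
        using False by auto
      also have "(\<Prod>\<alpha>\<in>I. prob (Y \<alpha> -` {f \<alpha>} \<inter> space M)) = (\<Prod>\<alpha>\<in>I. pmf (p \<alpha>) (f \<alpha>))"
      proof (intro prod.cong refl)
        fix \<alpha> assume "\<alpha> \<in> I"
        then show "prob (Y \<alpha> -` {f \<alpha>} \<inter> space M) = pmf (p \<alpha>) (f \<alpha>)"
          using measure_distr[OF meas, of \<alpha> "{f \<alpha>}"] law[of \<alpha>] by (simp add: measure_pmf_single)
      qed
      finally show ?thesis .
    qed
    then show "emeasure (distr M (count_space UNIV) ?Y) {f} =
      emeasure (measure_pmf (Pi_pmf I undefined p)) {f}"
      using f vimage[OF f] Y assms(1)
      by (simp add: emeasure_distr emeasure_eq_measure emeasure_pmf_single pmf_Pi PiE_def extensional_def)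
  qed (use count in auto)
qed

section \<open>Counting labelled set partitions\<close>

text \<open>Extensional labellings represent each labelled partition once. Counts are prescribed for
  all pairs, so zeros of \<open>y\<close> exclude block sizes and labels.\<close>

definition labelled_partitions ::
  "nat set \<Rightarrow> (nat \<times> nat \<Rightarrow> nat) \<Rightarrow> (nat set set \<times> (nat set \<Rightarrow> nat)) set" where
  "labelled_partitions S y = {(P, f). partition_on S P \<and> f \<in> extensional P \<and>
     (\<forall>i j. card {B \<in> P. card B = i \<and> f B = j} = y (i, j))}"

lemma labelled_partitions_label:
  assumes "finite S" "(P, f) \<in> labelled_partitions S y" "B \<in> P"
  shows "y (card B, f B) > 0"
proof -
  have "finite P"
    using assms by (auto simp: labelled_partitions_def intro: finite_elements)
  then have "card {C \<in> P. card C = card B \<and> f C = f B} > 0"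
    using assms(3) by (subst card_gt_0_iff) auto
  then show ?thesis
    using assms(2) by (auto simp: labelled_partitions_def)
qed

lemma finite_labelled_partitions:
  assumes "finite S" "finite J" "\<And>\<alpha>. \<alpha> \<notin> J \<Longrightarrow> y \<alpha> = 0"
  shows "finite (labelled_partitions S y)"
proof (rule finite_subset)
  show "labelled_partitions S y \<subseteq> (SIGMA P:Pow (Pow S). PiE P (\<lambda>_. snd ` J))"
  proof (rule subrelI)
    fix P f assume Pf: "(P, f) \<in> labelled_partitions S y"
    then have "P \<in> Pow (Pow S)"
      by (auto simp: labelled_partitions_def dest: partition_onD1)
    moreover
    have "(card B, f B) \<in> J" if "B \<in> P" for B
      using labelled_partitions_label[OF assms(1) Pf that] assms(3) by fastforce
    then have "f \<in> PiE P (\<lambda>_. snd ` J)"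
      using Pf by (force simp: labelled_partitions_def PiE_def)
    ultimately show "(P, f) \<in> (SIGMA P:Pow (Pow S). PiE P (\<lambda>_. snd ` J))"
      by simp
  qed
  have "finite (PiE P (\<lambda>_. snd ` J))" if "P \<subseteq> Pow S" for P
    using that assms by (intro finite_PiE) (auto intro: finite_subset)
  then show "finite (SIGMA P:Pow (Pow S). PiE P (\<lambda>_. snd ` J))"
    using assms by (intro finite_SigmaI) auto
qed

text \<open>One direction of the bijection that deletes a marked block; the lemma on insertion
  supplies its inverse.\<close>

lemma labelled_partitions_remove:
  assumes "finite S" "(P, f) \<in> labelled_partitions S y" "B \<in> P"
  defines "\<alpha> \<equiv> (card B, f B)"
  shows "(P - {B}, restrict f (P - {B})) \<in> labelled_partitions (S - B) (y(\<alpha> := y \<alpha> - 1))"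
proof -
  have part: "partition_on S P" and ext: "f \<in> extensional P"
    and y: "\<And>i j. card {B \<in> P. card B = i \<and> f B = j} = y (i, j)"
    using assms(2) by (auto simp: labelled_partitions_def)
  have "disjnt B (\<Union>(P - {B}))"
    using partition_onD2[OF part] assms(3) by (auto simp: disjoint_def disjnt_def)
  then have "partition_on (S - B) (P - {B})"
    using partition_on_insert[of B "P - {B}" S] part assms(3) by (simp add: insert_absorb)
  moreover have "card {C \<in> P - {B}. card C = i \<and> restrict f (P - {B}) C = j} =
    (y(\<alpha> := y \<alpha> - 1)) (i, j)" for i j
  proof -
    have "{C \<in> P - {B}. card C = i \<and> restrict f (P - {B}) C = j} =
      {C \<in> P. card C = i \<and> f C = j} - {B}"
      by auto
    then show ?thesis
      using assms(3) y[of i j] by (auto simp: card_Diff_singleton_if \<alpha>_def)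
  qed
  ultimately show ?thesis
    by (auto simp: labelled_partitions_def)
qed

text \<open>A nonempty \<open>B\<close> disjoint from the blocks in \<open>P\<close> cannot be one
  of them, so exactly one count rises. Positivity of \<open>y \<alpha>\<close> lets this undo the
  truncated subtraction.\<close>

lemma labelled_partitions_insert:
  assumes "finite S" "(P, f) \<in> labelled_partitions (S - B) (y(\<alpha> := y \<alpha> - 1))"
    and "B \<subseteq> S" "B \<noteq> {}" "\<alpha> = (card B, j)" "y \<alpha> > 0"
  shows "B \<notin> P" "(insert B P, f(B := j)) \<in> labelled_partitions S y"
proof -
  have part: "partition_on (S - B) P" and ext: "f \<in> extensional P"
    and y: "\<And>i j. card {B \<in> P. card B = i \<and> f B = j} = (y(\<alpha> := y \<alpha> - 1)) (i, j)"
    using assms(2) by (auto simp: labelled_partitions_def)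
  have disj: "disjnt B (\<Union>P)"
    using partition_onD1[OF part] by (auto simp: disjnt_def)
  show B: "B \<notin> P"
    using disj assms(4) by (auto simp: disjnt_def)
  have fin: "finite P"
    using assms(1) part by (auto intro: finite_elements)
  have "card {C \<in> insert B P. card C = i \<and> (f(B := j)) C = l} = y (i, l)" for i l
  proof -
    have "{C \<in> insert B P. card C = i \<and> (f(B := j)) C = l} =
      (if (i, l) = \<alpha> then insert B {C \<in> P. card C = i \<and> f C = l}
       else {C \<in> P. card C = i \<and> f C = l})"
      using B assms(5) by auto
    then show ?thesis
      using fin B assms(6) y[of i l] by auto
  qed
  then show "(insert B P, f(B := j)) \<in> labelled_partitions S y"
    using part ext partition_on_insert[OF disj, of S] assms(3,4)
    by (auto simp: labelled_partitions_def extensional_def)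
qed

text \<open>Counts the pairs of a labelled partition and one of its blocks of size \<open>i\<close> and label \<open>j\<close>.\<close>

lemma labelled_partitions_recurrence:
  assumes "finite S" "finite J" "\<And>\<alpha>. \<alpha> \<notin> J \<Longrightarrow> y \<alpha> = 0" "y (i, j) > 0" "i > 0"
  shows "y (i, j) * card (labelled_partitions S y) =
    (\<Sum>B | B \<subseteq> S \<and> card B = i. card (labelled_partitions (S - B) (y((i, j) := y (i, j) - 1))))"
proof -
  let ?y = "y((i, j) := y (i, j) - 1)"
  let ?L = "SIGMA Pf:labelled_partitions S y. {B \<in> fst Pf. card B = i \<and> snd Pf B = j}"
  let ?R = "SIGMA B:{B. B \<subseteq> S \<and> card B = i}. labelled_partitions (S - B) ?y"
  have finL: "finite (labelled_partitions S y)"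
    by (rule finite_labelled_partitions[OF assms(1-3)])
  have finR: "finite (labelled_partitions (S - B) ?y)" for B
    using assms(1-3) by (intro finite_labelled_partitions[of _ J]) auto
  \<comment> \<open>Deletes the marked block but remembers it as a set; its label \<open>j\<close>
    is fixed, so it can be put back.\<close>
  have "bij_betw (\<lambda>((P, f), B). (B, P - {B}, restrict f (P - {B}))) ?L ?R"
  proof (rule bij_betw_byWitness[where f' = "\<lambda>(B, P, f). ((insert B P, f(B := j)), B)"])
    show "\<forall>a\<in>?L. (\<lambda>(B, P, f). ((insert B P, f(B := j)), B))
      ((\<lambda>((P, f), B). (B, P - {B}, restrict f (P - {B}))) a) = a"
      by (auto simp: labelled_partitions_def extensional_def restrict_def fun_eq_iff)
    have ins: "B \<notin> P" "(insert B P, f(B := j)) \<in> labelled_partitions S y"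
      if "B \<subseteq> S" "card B = i" "(P, f) \<in> labelled_partitions (S - B) ?y" for B P f
    proof -
      have "B \<noteq> {}"
        using that(2) assms(5) by auto
      then show "B \<notin> P" "(insert B P, f(B := j)) \<in> labelled_partitions S y"
        using labelled_partitions_insert[OF assms(1) that(3,1), of j] that(2) assms(4) by auto
    qed
    have ext: "f \<in> extensional P" if "(P, f) \<in> labelled_partitions (S - B) ?y" for B P f
      using that by (simp add: labelled_partitions_def)
    show "\<forall>a\<in>?R. (\<lambda>((P, f), B). (B, P - {B}, restrict f (P - {B})))
      ((\<lambda>(B, P, f). ((insert B P, f(B := j)), B)) a) = a"
    proof
      fix a assume "a \<in> ?R"
      then obtain B P f where a: "a = (B, P, f)"
        and *: "B \<subseteq> S" "card B = i" "(P, f) \<in> labelled_partitions (S - B) ?y"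
        by auto
      have "(B, insert B P - {B}, restrict (f(B := j)) (insert B P - {B})) = (B, P, f)"
        using ins(1)[OF *] ext[OF *(3)] by (auto simp: extensional_def restrict_def fun_eq_iff)
      then show "(\<lambda>((P, f), B). (B, P - {B}, restrict f (P - {B})))
        ((\<lambda>(B, P, f). ((insert B P, f(B := j)), B)) a) = a"
        by (simp only: a prod.case)
    qed
    show "(\<lambda>((P, f), B). (B, P - {B}, restrict f (P - {B}))) ` ?L \<subseteq> ?R"
    proof clarsimp
      fix P f B assume Pf: "(P, f) \<in> labelled_partitions S y" "B \<in> P" "i = card B" "j = f B"
      then have "B \<subseteq> S"
        by (auto simp: labelled_partitions_def dest: partition_onD1)
      then show "B \<subseteq> S \<and> (P - {B}, restrict f (P - {B})) \<in> labelled_partitions (S - B)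
        (y((card B, f B) := y (card B, f B) - Suc 0))"
        using labelled_partitions_remove[OF assms(1) Pf(1,2)] by simp
    qed
    show "(\<lambda>(B, P, f). ((insert B P, f(B := j)), B)) ` ?R \<subseteq> ?L"
      using ins by auto
  qed
  then have "card ?L = card ?R"
    by (rule bij_betw_same_card)
  \<comment> \<open>Every labelled partition has exactly \<open>y (i, j)\<close> blocks that can be
    marked.\<close>
  moreover have "card ?L = (\<Sum>Pf\<in>labelled_partitions S y. y (i, j))"
  proof (subst card_SigmaI)
    have "finite (fst Pf)" if "Pf \<in> labelled_partitions S y" for Pf
      using that assms(1) by (auto simp: labelled_partitions_def intro: finite_elements)
    then show "\<forall>a\<in>labelled_partitions S y. finite {B \<in> fst a. card B = i \<and> snd a B = j}"
      by simp
    show "(\<Sum>Pf\<in>labelled_partitions S y. card {B \<in> fst Pf. card B = i \<and> snd Pf B = j}) =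
      (\<Sum>Pf\<in>labelled_partitions S y. y (i, j))"
      by (intro sum.cong) (auto simp: labelled_partitions_def)
  qed (use finL in simp)
  moreover have "card ?R = (\<Sum>B | B \<subseteq> S \<and> card B = i. card (labelled_partitions (S - B) ?y))"
    using finR assms(1) by (subst card_SigmaI) auto
  ultimately show ?thesis
    by (simp add: mult.commute)
qed

text \<open>The classical count of set partitions of given type, in product form to avoid division.
  The induction is on the number of blocks and uses the recurrence for a marked block.\<close>

lemma card_labelled_partitions:
  assumes "finite J" "finite S" "\<And>\<alpha>. \<alpha> \<notin> J \<Longrightarrow> y \<alpha> = 0" "\<And>\<alpha>. \<alpha> \<in> J \<Longrightarrow> fst \<alpha> > 0"
    and "(\<Sum>\<alpha>\<in>J. fst \<alpha> * y \<alpha>) = card S"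
  shows "card (labelled_partitions S y) * (\<Prod>\<alpha>\<in>J. fact (fst \<alpha>) ^ y \<alpha> * fact (y \<alpha>)) = (fact (card S) :: nat)"
  using assms(2,3,5)
proof (induction "sum y J" arbitrary: S y)
  case 0
  then have "y \<alpha> = 0" for \<alpha>
    using assms(1) by (cases "\<alpha> \<in> J") auto
  then have y: "y = (\<lambda>_. 0)"
    by blast
  then have "S = {}"
    using 0 by simp
  \<comment> \<open>The empty partition with its everywhere undefined labelling is the single
    object, matching \<open>fact 0 = 1\<close>.\<close>
  moreover have "labelled_partitions {} y = {({}, \<lambda>_. undefined)}"
    by (auto simp: labelled_partitions_def y partition_on_empty extensional_def)
  ultimately show ?case
    using y by simp
next
  case (Suc k)
  then obtain \<alpha> where \<alpha>: "\<alpha> \<in> J" "y \<alpha> > 0"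
    by (metis gr0I nat.distinct(1) sum.neutral)
  obtain i j where ij: "\<alpha> = (i, j)"
    by fastforce
  have i: "i > 0"
    using assms(4)[OF \<alpha>(1)] ij by simp
  define z where "z = y(\<alpha> := y \<alpha> - 1)"
  have z: "y = z(\<alpha> := Suc (z \<alpha>))" "y \<alpha> = Suc (z \<alpha>)"
    using \<alpha>(2) by (auto simp: z_def)
  have split: "sum g J = g \<alpha> + sum g (J - {\<alpha>})" for g :: "nat \<times> nat \<Rightarrow> nat"
    using assms(1) \<alpha>(1) by (rule sum.remove)
  have psplit: "prod g J = g \<alpha> * prod g (J - {\<alpha>})" for g :: "nat \<times> nat \<Rightarrow> nat"
    using assms(1) \<alpha>(1) by (rule prod.remove)
  have rest: "(\<Sum>\<beta>\<in>J - {\<alpha>}. h \<beta> (y \<beta>)) = (\<Sum>\<beta>\<in>J - {\<alpha>}. h \<beta> (z \<beta>))" for h :: "nat \<times> nat \<Rightarrow> nat \<Rightarrow> nat"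
    by (intro sum.cong) (auto simp: z_def)
  have prest: "(\<Prod>\<beta>\<in>J - {\<alpha>}. h \<beta> (y \<beta>)) = (\<Prod>\<beta>\<in>J - {\<alpha>}. h \<beta> (z \<beta>))" for h :: "nat \<times> nat \<Rightarrow> nat \<Rightarrow> nat"
    by (intro prod.cong) (auto simp: z_def)
  have k: "k = sum z J"
    using Suc(2) split[of y] split[of z] rest[of "\<lambda>_ v. v"] z(2) by simp
  have w: "card S = i + (\<Sum>\<alpha>\<in>J. fst \<alpha> * z \<alpha>)"
    using Suc.prems(3) split[of "\<lambda>\<alpha>. fst \<alpha> * y \<alpha>"] split[of "\<lambda>\<alpha>. fst \<alpha> * z \<alpha>"]
      rest[of "\<lambda>\<beta> v. fst \<beta> * v"] z(2) ij by simp
  let ?D = "\<lambda>y. \<Prod>\<alpha>\<in>J. fact (fst \<alpha>) ^ y \<alpha> * fact (y \<alpha>) :: nat"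
  \<comment> \<open>One more block of size \<open>i\<close> multiplies the power by
    \<open>fact i\<close> and the factorial of the count by \<open>y \<alpha>\<close>; the latter is
    the multiplicity in the recurrence.\<close>
  have D: "?D y = fact i * y \<alpha> * ?D z"
    using psplit[of "\<lambda>\<alpha>. fact (fst \<alpha>) ^ y \<alpha> * fact (y \<alpha>)"]
      psplit[of "\<lambda>\<alpha>. fact (fst \<alpha>) ^ z \<alpha> * fact (z \<alpha>)"]
      prest[of "\<lambda>\<beta> v. fact (fst \<beta>) ^ v * fact v"] z(2) ij by (simp add: algebra_simps)
  have IH: "card (labelled_partitions (S - B) z) * ?D z = fact (card S - i)"
    if "B \<subseteq> S" "card B = i" for B
  proof -
    have "card (S - B) = card S - i"
      using that Suc.prems(1) by (simp add: card_Diff_subset finite_subset)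
    moreover have "z \<beta> = 0" if "\<beta> \<notin> J" for \<beta>
      using that Suc.prems(2)[OF that] \<alpha>(1) by (auto simp: z_def)
    ultimately show ?thesis
      using Suc.hyps(1)[OF k, of "S - B"] Suc.prems(1) w by simp
  qed
  have rec: "y \<alpha> * card (labelled_partitions S y) =
    (\<Sum>B | B \<subseteq> S \<and> card B = i. card (labelled_partitions (S - B) z))"
    unfolding ij z_def using \<alpha> i Suc.prems(2)
    by (intro labelled_partitions_recurrence[OF Suc.prems(1) assms(1)]) (auto simp: ij)
  have "y \<alpha> * card (labelled_partitions S y) * ?D z =
    (\<Sum>B | B \<subseteq> S \<and> card B = i. card (labelled_partitions (S - B) z) * ?D z)"
    using rec by (simp add: sum_distrib_right)
  \<comment> \<open>By induction each term depends only on the size of \<open>B\<close>, leaving a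
    binomial coefficient times one factorial.\<close>
  also have "\<dots> = (\<Sum>B | B \<subseteq> S \<and> card B = i. fact (card S - i))"
    by (intro sum.cong) (auto simp: IH)
  also have "\<dots> = (card S choose i) * fact (card S - i)"
    using n_subsets[OF Suc.prems(1), of i] by simp
  finally have "card (labelled_partitions S y) * ?D y =
    fact i * fact (card S - i) * (card S choose i)"
    unfolding D by (simp add: algebra_simps)
  then show ?case
    using binomial_fact_lemma[of i "card S"] w by simp
qed

section \<open>The conditioning relation\<close>

lemma finite_refined_index: "finite (refined_index m n)"
proof -
  have "refined_index m n = (SIGMA i:{1..n}. {1..m i})"
    by (auto simp: refined_index_def)
  then show ?thesis
    by simp
qed

lemma refined_index_pos: "\<alpha> \<in> refined_index m n \<Longrightarrow> fst \<alpha> > 0"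
  by (auto simp: refined_index_def)

text \<open>Being \<open>undefined\<close> off the index set matches the default of the product law,
  so both describe the same extensional functions.\<close>

definition component_counts :: "(nat \<Rightarrow> nat) \<Rightarrow> nat \<Rightarrow> comb_object \<Rightarrow> nat \<times> nat \<Rightarrow> nat" where
  "component_counts m n s = (\<lambda>\<alpha>\<in>refined_index m n. component_count s \<alpha>)"

abbreviation fibre ::
    "comb_class \<Rightarrow> (nat \<Rightarrow> nat) \<Rightarrow> nat \<Rightarrow> (nat \<times> nat \<Rightarrow> nat) \<Rightarrow> comb_object set" where
  "fibre c m n f \<equiv> {s \<in> comb_objects c m n. component_counts m n s = f}"

lemma assembly_block_index:
  assumes "partition_on {1..n} P" "f \<in> (\<Pi>\<^sub>E B\<in>P. {1..m (card B)})" "B \<in> P"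
  shows "(card B, f B) \<in> refined_index m n"
proof -
  have "B \<subseteq> {1..n}" "B \<noteq> {}"
    using assms(1,3) by (auto dest: partition_onD1 partition_onD3)
  then have "card B \<ge> 1" "card B \<le> n"
    using card_mono[of "{1..n}" B] by (auto simp: Suc_le_eq card_gt_0_iff intro: finite_subset)
  then show ?thesis
    using assms(2,3) by (auto simp: refined_index_def)
qed

text \<open>Extending \<open>f\<close> by 0 rules out every block whose size and label lie outside
  the index set, which encodes the label bound \<open>m (card B)\<close> in the counts.\<close>

lemma fibre_Assemblies:
  assumes "f \<in> extensional (refined_index m n)"
  shows "fibre Assemblies m n f = case_prod Assembly `
    labelled_partitions {1..n} (\<lambda>\<alpha>. if \<alpha> \<in> refined_index m n then f \<alpha> else 0)"
    (is "_ = _ ` labelled_partitions _ ?y")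
proof (intro set_eqI iffI)
  fix s assume "s \<in> fibre Assemblies m n f"
  then obtain P g where s: "s = Assembly P g" and part: "partition_on {1..n} P"
    and g: "g \<in> (\<Pi>\<^sub>E B\<in>P. {1..m (card B)})" and f: "component_counts m n s = f"
    by auto
  have "card {B \<in> P. card B = i \<and> g B = j} = ?y (i, j)" for i j
  proof (cases "(i, j) \<in> refined_index m n")
    case True
    then show ?thesis
      using fun_cong[OF f, of "(i, j)"] by (simp add: s component_counts_def)
  next
    case False
    then have "{B \<in> P. card B = i \<and> g B = j} = {}"
      using assembly_block_index[OF part g] by auto
    then show ?thesis
      using False by (simp only: card.empty if_False)
  qed
  then have "(P, g) \<in> labelled_partitions {1..n} ?y"
    using part g by (simp add: labelled_partitions_def PiE_def)
  then show "s \<in> case_prod Assembly ` labelled_partitions {1..n} ?y"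
    unfolding s by (force intro: image_eqI[of _ _ "(P, g)"])
next
  fix s assume "s \<in> case_prod Assembly ` labelled_partitions {1..n} ?y"
  then obtain P g where s: "s = Assembly P g" and Pg: "(P, g) \<in> labelled_partitions {1..n} ?y"
    by auto
  have "(card B, g B) \<in> refined_index m n" if "B \<in> P" for B
    using labelled_partitions_label[OF _ Pg that] by (auto split: if_splits)
  then have "g \<in> (\<Pi>\<^sub>E B\<in>P. {1..m (card B)})"
    using Pg by (auto simp: labelled_partitions_def PiE_def refined_index_def)
  moreover have "component_counts m n s = f"
  proof
    fix \<alpha>
    show "component_counts m n s \<alpha> = f \<alpha>"
      using Pg assms by (cases \<alpha>)
        (auto simp: component_counts_def s labelled_partitions_def restrict_def extensional_def)
  qed
  ultimately show "s \<in> fibre Assemblies m n f"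
    using Pg by (auto simp: s labelled_partitions_def)
qed

lemma sum_mset_eq_sum_count:
  fixes h :: "'b \<Rightarrow> nat"
  assumes "finite I" "set_mset A \<subseteq> I"
  shows "(\<Sum>\<alpha>\<in>#A. h \<alpha>) = (\<Sum>\<alpha>\<in>I. h \<alpha> * count A \<alpha>)"
  using assms(2)
proof (induction A)
  case (add a A)
  have "(\<Sum>\<alpha>\<in>I. h \<alpha> * count (add_mset a A) \<alpha>) =
    (\<Sum>\<alpha>\<in>I. (if \<alpha> = a then h \<alpha> else 0) + h \<alpha> * count A \<alpha>)"
    by (intro sum.cong) auto
  then show ?case
    using add assms(1) by (simp add: sum.distrib)
qed simp

lemma multiset_subset_index:
  assumes "set_mset A \<subseteq> objects m" "(\<Sum>\<alpha>\<in>#A. fst \<alpha>) = n"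
  shows "set_mset A \<subseteq> refined_index m n"
proof
  fix \<alpha> assume "\<alpha> \<in># A"
  then have "fst \<alpha> \<le> n"
    using assms(2) by (auto dest!: multi_member_split)
  then show "\<alpha> \<in> refined_index m n"
    using \<open>\<alpha> \<in># A\<close> assms(1) by (auto simp: objects_def refined_index_def)
qed

lemma selection_subset_index:
  assumes "finite A" "A \<subseteq> objects m" "(\<Sum>\<alpha>\<in>A. fst \<alpha>) = n"
  shows "A \<subseteq> refined_index m n"
proof
  fix \<alpha> assume "\<alpha> \<in> A"
  then have "fst \<alpha> \<le> n"
    using assms member_le_sum[of \<alpha> A fst] by auto
  then show "\<alpha> \<in> refined_index m n"
    using \<open>\<alpha> \<in> A\<close> assms(2) by (auto simp: objects_def refined_index_def)
qed

lemma refined_index_subset_objects: "refined_index m n \<subseteq> objects m"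
  by (auto simp: objects_def refined_index_def)

text \<open>A multiset is its multiplicity function, and total weight \<open>n\<close> leaves no
  room for objects outside the index set.\<close>

lemma fibre_Multisets:
  assumes "f \<in> extensional (refined_index m n)" "weight (refined_index m n) f = n"
  shows "fibre Multisets m n f =
    {Multiset (Abs_multiset (\<lambda>\<alpha>. if \<alpha> \<in> refined_index m n then f \<alpha> else 0))}"
    (is "_ = {Multiset (Abs_multiset ?y)}")
proof (intro set_eqI iffI)
  have count: "count (Abs_multiset ?y) = ?y"
    by (rule count_Abs_multiset, rule finite_subset[OF _ finite_refined_index[of m n]]) auto
  {
    fix s assume "s \<in> fibre Multisets m n f"
    then obtain A where s: "s = Multiset A" and A: "set_mset A \<subseteq> objects m" "(\<Sum>\<alpha>\<in>#A. fst \<alpha>) = n"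
      and f: "component_counts m n s = f"
      by auto
    have "A = Abs_multiset ?y"
    proof (rule multiset_eqI)
      fix \<alpha>
      show "count A \<alpha> = count (Abs_multiset ?y) \<alpha>"
        using multiset_subset_index[OF A] fun_cong[OF f, of \<alpha>]
        by (cases \<alpha>) (auto simp: count s component_counts_def restrict_def not_in_iff)
    qed
    then show "s \<in> {Multiset (Abs_multiset ?y)}"
      by (simp add: s)
  }
  fix s assume "s \<in> {Multiset (Abs_multiset ?y)}"
  then have s: "s = Multiset (Abs_multiset ?y)"
    by simp
  have sub: "set_mset (Abs_multiset ?y) \<subseteq> refined_index m n"
    by (auto simp: set_mset_def count split: if_splits)
  have "(\<Sum>\<alpha>\<in>#Abs_multiset ?y. fst \<alpha>) = n"
    using assms(2) by (simp add: sum_mset_eq_sum_count[OF finite_refined_index sub] count)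
  moreover have "component_counts m n s = f"
  proof
    fix \<alpha>
    show "component_counts m n s \<alpha> = f \<alpha>"
      using assms(1)
      by (cases \<alpha>) (auto simp: component_counts_def s count restrict_def extensional_def)
  qed
  ultimately show "s \<in> fibre Multisets m n f"
    using sub refined_index_subset_objects[of m n] by (auto simp: s)
qed

text \<open>As for multisets, except that a count above 1 cannot come from a set.\<close>

lemma fibre_Selections:
  assumes "f \<in> extensional (refined_index m n)" "weight (refined_index m n) f = n"
  shows "fibre Selections m n f =
    (if \<forall>\<alpha>\<in>refined_index m n. f \<alpha> \<le> 1 then {Selection {\<alpha> \<in> refined_index m n. f \<alpha> = 1}} else {})"
proof -
  let ?I = "refined_index m n" and ?A = "{\<alpha> \<in> refined_index m n. f \<alpha> = 1}"
  have sub: "s = Selection ?A \<and> (\<forall>\<alpha>\<in>?I. f \<alpha> \<le> 1)" if s_in: "s \<in> fibre Selections m n f" for s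
  proof -
    obtain A where s: "s = Selection A"
      and A: "finite A" "A \<subseteq> objects m" "(\<Sum>\<alpha>\<in>A. fst \<alpha>) = n"
      using s_in by auto
    have f: "component_counts m n s = f"
      using s_in by simp
    have f': "f \<alpha> = of_bool (\<alpha> \<in> A)" if "\<alpha> \<in> ?I" for \<alpha>
      using fun_cong[OF f, of \<alpha>] that by (cases \<alpha>) (simp add: s component_counts_def)
    then have "A = ?A"
      using selection_subset_index[OF A] by (auto simp del: One_nat_def)
    moreover have "\<forall>\<alpha>\<in>?I. f \<alpha> \<le> 1"
      by (simp add: f')
    ultimately show ?thesis
      using s by blast
  qed
  have "Selection ?A \<in> fibre Selections m n f" if le: "\<forall>\<alpha>\<in>?I. f \<alpha> \<le> 1"
  proof -
    have "(\<Sum>\<alpha>\<in>?A. fst \<alpha>) = (\<Sum>\<alpha>\<in>?A. fst \<alpha> * f \<alpha>)"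
      by (intro sum.cong) auto
    also have "\<dots> = weight ?I f"
      using le finite_refined_index[of m n]
      by (intro sum.mono_neutral_left) (auto simp: le_Suc_eq)
    finally have "(\<Sum>\<alpha>\<in>?A. fst \<alpha>) = n"
      using assms(2) by simp
    moreover have "component_counts m n (Selection ?A) = f"
    proof
      fix \<alpha>
      have "\<alpha> \<in> ?I \<Longrightarrow> f \<alpha> = 0 \<or> f \<alpha> = 1"
        using le by (auto simp: le_Suc_eq)
      then show "component_counts m n (Selection ?A) \<alpha> = f \<alpha>"
        using assms(1)
        by (cases \<alpha>) (auto simp: component_counts_def restrict_def extensional_def)
    qed
    ultimately show ?thesis
      using finite_refined_index[of m n] refined_index_subset_objects[of m n] by auto
  qed
  then show ?thesis
    using sub by (auto simp del: comb_objects.simps)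
qed

section \<open>Total weight and finiteness of the structures\<close>

lemma finite_fibre:
  assumes "f \<in> extensional (refined_index m n)" "weight (refined_index m n) f = n"
  shows "finite (fibre c m n f)"
proof (cases c)
  case Assemblies
  have "finite (labelled_partitions {1..n} (\<lambda>\<alpha>. if \<alpha> \<in> refined_index m n then f \<alpha> else 0))"
    by (rule finite_labelled_partitions[OF _ finite_refined_index[of m n]]) auto
  then show ?thesis
    unfolding Assemblies fibre_Assemblies[OF assms(1)] by (rule finite_imageI)
next
  case Multisets
  show ?thesis
    unfolding Multisets fibre_Multisets[OF assms] by simp
next
  case Selections
  show ?thesis
    unfolding Selections fibre_Selections[OF assms] by simp
qed

lemma weight_component_counts:
  assumes "s \<in> comb_objects c m n"
  shows "weight (refined_index m n) (component_counts m n s) = n"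
proof -
  let ?I = "refined_index m n"
  have "weight ?I (component_counts m n s) = (\<Sum>\<alpha>\<in>?I. fst \<alpha> * component_count s \<alpha>)"
    by (intro sum.cong) (auto simp: component_counts_def)
  also have "\<dots> = n"
  proof (cases c)
    case Assemblies
    then obtain P f where s: "s = Assembly P f" and part: "partition_on {1..n} P"
      and f: "f \<in> (\<Pi>\<^sub>E B\<in>P. {1..m (card B)})"
      using assms by auto
    have fin: "finite P"
      using part by (auto intro: finite_elements)
    have "(\<Sum>\<alpha>\<in>?I. fst \<alpha> * component_count s \<alpha>) =
      (\<Sum>\<alpha>\<in>?I. \<Sum>B | B \<in> P \<and> (card B, f B) = \<alpha>. card B)"
    proof (intro sum.cong refl)
      fix \<alpha> :: "nat \<times> nat"
      obtain i j where \<alpha>: "\<alpha> = (i, j)"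
        by fastforce
      have "(\<Sum>B | B \<in> P \<and> (card B, f B) = \<alpha>. card B) = (\<Sum>B | B \<in> P \<and> card B = i \<and> f B = j. i)"
        by (intro sum.cong) (auto simp: \<alpha>)
      then show "fst \<alpha> * component_count s \<alpha> = (\<Sum>B | B \<in> P \<and> (card B, f B) = \<alpha>. card B)"
        by (simp add: \<alpha> s)
    qed
    \<comment> \<open>Grouping blocks by size and label loses none, since every such pair lies in
      the index set; the block sizes then add up to \<open>n\<close>.\<close>
    also have "\<dots> = (\<Sum>B\<in>P. card B)"
      using fin finite_refined_index assembly_block_index[OF part f]
      by (intro sum.group) auto
    also have "\<dots> = card (\<Union>P)"
      using partition_onD2[OF part] partition_onD1[OF part]
      by (intro card_Union_disjoint[symmetric]) (metis, metis Union_upper finite_atLeastAtMost finite_subset)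
    also have "\<dots> = n"
      using partition_onD1[OF part] by (metis card_atLeastAtMost diff_Suc_1)
    finally show ?thesis .
  next
    case Multisets
    then obtain A where s: "s = Multiset A" and A: "set_mset A \<subseteq> objects m" "(\<Sum>\<alpha>\<in>#A. fst \<alpha>) = n"
      using assms by auto
    have "component_count s \<alpha> = count A \<alpha>" for \<alpha>
      by (cases \<alpha>) (simp add: s)
    then show ?thesis
      using sum_mset_eq_sum_count[OF finite_refined_index multiset_subset_index[OF A], of fst] A(2)
      by simp
  next
    case Selections
    then obtain A where s: "s = Selection A"
      and A: "finite A" "A \<subseteq> objects m" "(\<Sum>\<alpha>\<in>A. fst \<alpha>) = n"
      using assms by auto
    have count: "component_count s \<alpha> = of_bool (\<alpha> \<in> A)" for \<alpha>
      by (cases \<alpha>) (simp add: s)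
    have "(\<Sum>\<alpha>\<in>?I. fst \<alpha> * component_count s \<alpha>) = (\<Sum>\<alpha>\<in>A. fst \<alpha> * component_count s \<alpha>)"
      using selection_subset_index[OF A] finite_refined_index[of m n]
      by (intro sum.mono_neutral_right) (auto simp: count)
    then show ?thesis
      using A(3) by (simp add: count)
  qed
  finally show ?thesis .
qed

text \<open>All indices have positive weight, so counts of total weight \<open>n\<close> are at most
  \<open>n\<close>. Finitely many count vectors, each with a finite fibre, remain.\<close>

lemma finite_comb_objects: "finite (comb_objects c m n)"
proof -
  let ?I = "refined_index m n"
  let ?F = "{f \<in> PiE ?I (\<lambda>_. {..n}). weight ?I f = n}"
  have "comb_objects c m n \<subseteq> (\<Union>f\<in>?F. fibre c m n f)"
  proof
    fix s assume s: "s \<in> comb_objects c m n"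
    have "component_counts m n s \<alpha> \<le> n" if \<alpha>: "\<alpha> \<in> ?I" for \<alpha>
    proof -
      have "component_counts m n s \<alpha> \<le> fst \<alpha> * component_counts m n s \<alpha>"
        using refined_index_pos[OF \<alpha>] by simp
      also have "\<dots> \<le> weight ?I (component_counts m n s)"
        using \<alpha> finite_refined_index by (intro member_le_sum) auto
      finally show ?thesis
        using weight_component_counts[OF s] by simp
    qed
    then have "component_counts m n s \<in> ?F"
      using weight_component_counts[OF s] by (simp add: component_counts_def Int_absorb1)
    then show "s \<in> (\<Union>f\<in>?F. fibre c m n f)"
      using s by blast
  qed
  moreover have "finite ?F"
    using finite_refined_index[of m n] by (simp add: finite_PiE)
  ultimately show ?thesis
    using finite_fibre by (auto simp: PiE_def intro: finite_subset simp del: comb_objects.simps)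
qed

section \<open>Proportionality of the independent law to the fibre sizes\<close>

abbreviation refined_law :: "comb_class \<Rightarrow> real \<Rightarrow> (nat \<Rightarrow> nat) \<Rightarrow> nat \<Rightarrow> (nat \<times> nat \<Rightarrow> nat) pmf" where
  "refined_law c x m n \<equiv> Pi_pmf (refined_index m n) undefined (\<lambda>\<alpha>. component_law c x (fst \<alpha>))"

text \<open>Each factor of the product law is a normaliser free of \<open>f\<close>, a power of
  \<open>x\<close>, and a combinatorial term. At weight \<open>n\<close> the powers multiply to
  \<open>x ^ n\<close>, and the combinatorial terms give the fibre size, up to \<open>fact n\<close>
  for assemblies.\<close>

lemma pmf_refined_law:
  assumes "x > 0" "c = Multisets \<Longrightarrow> x < 1"
  shows "\<exists>C :: real. \<forall>f. weight (refined_index m n) f = n \<longrightarrow>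
    pmf (refined_law c x m n) f = C * card (fibre c m n f)"
proof -
  let ?I = "refined_index m n"
  \<comment> \<open>\<open>E\<close> gathers the normalisers, that is, the probabilities of count
    0.\<close>
  define E where "E = (\<Prod>\<alpha>\<in>?I. case c of Assemblies \<Rightarrow> exp (- (x ^ fst \<alpha> / fact (fst \<alpha>)))
    | Multisets \<Rightarrow> 1 - x ^ fst \<alpha> | Selections \<Rightarrow> 1 / (1 + x ^ fst \<alpha>))"
  define C where "C = E * x ^ n / (case c of Assemblies \<Rightarrow> fact n | _ \<Rightarrow> 1)"
  have "pmf (refined_law c x m n) f = C * card (fibre c m n f)" if w: "weight ?I f = n" for f
  proof (cases "f \<in> extensional ?I")
    \<comment> \<open>Both sides vanish: component counts and the support of the product law are
      extensional.\<close>
    case False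
    then have "fibre c m n f = {}"
      by (auto simp: component_counts_def simp del: comb_objects.simps)
    moreover have "pmf (refined_law c x m n) f = 0"
      using False by (intro pmf_Pi_outside finite_refined_index) (auto simp: extensional_def)
    ultimately show ?thesis
      by (simp only: card.empty of_nat_0 mult_zero_right)
  next
    case True
    then have pmf: "pmf (refined_law c x m n) f = (\<Prod>\<alpha>\<in>?I. pmf (component_law c x (fst \<alpha>)) (f \<alpha>))"
      by (intro pmf_Pi' finite_refined_index) (auto simp: extensional_def)
    have xn: "(\<Prod>\<alpha>\<in>?I. x ^ (fst \<alpha> * f \<alpha>)) = x ^ n"
      using w by (simp flip: power_sum)
    show ?thesis
    proof (cases c)
      case Assemblies
      let ?y = "\<lambda>\<alpha>. if \<alpha> \<in> ?I then f \<alpha> else 0"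
      define D where "D = (\<Prod>\<alpha>\<in>?I. fact (fst \<alpha>) ^ f \<alpha> * fact (f \<alpha>) :: nat)"
      have "pmf (refined_law c x m n) f = (\<Prod>\<alpha>\<in>?I. exp (- (x ^ fst \<alpha> / fact (fst \<alpha>))) *
        x ^ (fst \<alpha> * f \<alpha>) / real (fact (fst \<alpha>) ^ f \<alpha> * fact (f \<alpha>)))"
        unfolding pmf using assms(1)
        by (intro prod.cong) (auto simp: Assemblies power_divide power_mult)
      also have "\<dots> = E * x ^ n / D"
        by (simp add: prod_dividef prod.distrib xn E_def D_def Assemblies)
      finally have p: "pmf (refined_law c x m n) f = E * x ^ n / D" .
      have "(\<Sum>\<alpha>\<in>?I. fst \<alpha> * ?y \<alpha>) = n"
        using w by simp
      then have "card (labelled_partitions {1..n} ?y) *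
        (\<Prod>\<alpha>\<in>?I. fact (fst \<alpha>) ^ ?y \<alpha> * fact (?y \<alpha>)) = (fact (card {1..n}) :: nat)"
        by (intro card_labelled_partitions finite_refined_index) (auto dest: refined_index_pos)
      then have "card (labelled_partitions {1..n} ?y) * D = fact n"
        by (simp add: D_def)
      moreover have "card (fibre c m n f) = card (labelled_partitions {1..n} ?y)"
        unfolding Assemblies fibre_Assemblies[OF True]
        by (intro card_image) (auto simp: inj_on_def)
      ultimately have "card (fibre c m n f) * D = fact n"
        by simp
      then have N: "real (card (fibre c m n f)) * real D = fact n"
        by (simp only: flip: of_nat_mult) simp
      then have "real D \<noteq> 0" "real (card (fibre c m n f)) \<noteq> 0"
        using fact_nonzero[of n, where ?'a = real] by (metis mult_zero_right, metis mult_zero_left)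
      \<comment> \<open>By \<open>N\<close>, the reciprocal of \<open>D\<close> is the fibre size
        divided by \<open>fact n\<close>.\<close>
      then have "E * x ^ n / D = E * x ^ n / fact n * card (fibre c m n f)"
        unfolding N[symmetric] by (simp del: comb_objects.simps of_nat_eq_0_iff)
      then show ?thesis
        unfolding p by (simp only: C_def Assemblies comb_class.case)
    next
      case Multisets
      have "pmf (refined_law c x m n) f = (\<Prod>\<alpha>\<in>?I. (1 - x ^ fst \<alpha>) * x ^ (fst \<alpha> * f \<alpha>))"
        unfolding pmf
      proof (intro prod.cong refl)
        fix \<alpha> assume "\<alpha> \<in> ?I"
        \<comment> \<open>Positive weight keeps the geometric parameter
          \<open>1 - x ^ fst \<alpha>\<close> positive.\<close>
        then have "x ^ fst \<alpha> < 1"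
          using assms Multisets refined_index_pos by (simp add: power_less_one_iff)
        then show "pmf (component_law c x (fst \<alpha>)) (f \<alpha>) = (1 - x ^ fst \<alpha>) * x ^ (fst \<alpha> * f \<alpha>)"
          using assms(1) by (simp add: Multisets power_mult)
      qed
      then show ?thesis
        unfolding C_def E_def Multisets fibre_Multisets[OF True w]
        by (simp add: prod.distrib xn)
    next
      case Selections
      have law: "pmf (component_law c x i) k = (if k \<le> 1 then 1 / (1 + x ^ i) * x ^ (i * k) else 0)"
        for i k
      proof -
        have p: "0 \<le> x ^ i / (1 + x ^ i)" "x ^ i / (1 + x ^ i) \<le> 1"
          "1 - x ^ i / (1 + x ^ i) = 1 / (1 + x ^ i)"
          using assms(1) by (auto simp: field_simps add_pos_pos add_nonneg_eq_0_iff)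
        have inj: "inj (of_bool :: bool \<Rightarrow> nat)"
          by (auto simp: inj_def)
        consider "k = of_bool False" | "k = of_bool True" | "k > 1"
          by (cases "k = 0"; cases "k = 1") auto
        then show ?thesis
        proof cases
          case 1
          then show ?thesis
            using p pmf_map_inj'[OF inj, of "bernoulli_pmf (x ^ i / (1 + x ^ i))" False]
            by (simp add: Selections)
        next
          case 2
          then show ?thesis
            using p pmf_map_inj'[OF inj, of "bernoulli_pmf (x ^ i / (1 + x ^ i))" True]
            by (simp add: Selections)
        next
          case 3
          then show ?thesis
            by (auto simp: Selections pmf_eq_0_set_pmf of_bool_def split: if_splits)
        qed
      qed
      show ?thesis
      proof (cases "\<forall>\<alpha>\<in>?I. f \<alpha> \<le> 1")
        case le: True
        have "pmf (refined_law c x m n) f = (\<Prod>\<alpha>\<in>?I. 1 / (1 + x ^ fst \<alpha>) * x ^ (fst \<alpha> * f \<alpha>))"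
          unfolding pmf law using le by (intro prod.cong) auto
        also have "\<dots> = E * x ^ n"
          by (simp only: prod.distrib xn E_def Selections comb_class.case)
        finally show ?thesis
          unfolding C_def Selections fibre_Selections[OF True w] using le by simp
      next
        case gt: False
        then have "pmf (refined_law c x m n) f = 0"
          unfolding pmf law using finite_refined_index[of m n] by (auto intro: prod_zero)
        then show ?thesis
          unfolding Selections fibre_Selections[OF True w] using gt by auto
      qed
    qed
  qed
  then show ?thesis
    by blast
qed

section \<open>Equality of the two total variation distances\<close>

theorem theorem5:
  fixes m :: "nat \<Rightarrow> nat" and n :: nat and c :: comb_class and x :: real
    and M :: "'a measure" and Y :: "nat \<times> nat \<Rightarrow> 'a \<Rightarrow> nat" and K :: "(nat \<times> nat) set"
  assumes "n \<ge> 1"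
    and "x > 0"
    and "c = Multisets \<Longrightarrow> x < 1"
    and "prob_space M"
    and "prob_space.indep_vars M (\<lambda>_. count_space UNIV) Y (refined_index m n)"
    and "\<And>i j. (i, j) \<in> refined_index m n \<Longrightarrow>
           distr M (count_space UNIV) (Y (i, j)) = measure_pmf (component_law c x i)"
    and "\<P>(\<omega> in M. weighted_sum Y (refined_index m n) \<omega> = n) > 0"
    and "K \<subseteq> refined_index m n"
  shows "d_TV (measure_pmf (pmf_of_set (comb_objects c m n))) (\<lambda>s. \<lambda>\<alpha>\<in>K. component_count s \<alpha>)
              M (\<lambda>\<omega>. \<lambda>\<alpha>\<in>K. Y \<alpha> \<omega>) =
         d_TV (conditioned M (\<lambda>\<omega>. weighted_sum Y (refined_index m n) \<omega> = n)) (weighted_sum Y K)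
              M (weighted_sum Y K)"
proof -
  interpret prob_space M by fact
  let ?I = "refined_index m n" and ?p = "refined_law c x m n"
  let ?Y = "\<lambda>\<omega>. \<lambda>\<alpha>\<in>?I. Y \<alpha> \<omega>" and ?A = "{f. weight ?I f = n}" and ?S = "comb_objects c m n"
  let ?r = "\<lambda>f :: nat \<times> nat \<Rightarrow> nat. restrict f K"
  have "distr M (count_space UNIV) (Y \<alpha>) = measure_pmf (component_law c x (fst \<alpha>))"
    if "\<alpha> \<in> ?I" for \<alpha>
    using assms(6)[of "fst \<alpha>" "snd \<alpha>"] that by simp
  note distr = distr_restrict_eq_Pi_pmf[OF finite_refined_index assms(5) this]
  have prob: "\<P>(\<omega> in M. ?Y \<omega> \<in> B) = measure ?p B" for B
    using measure_distr[OF distr(1), of B] by (simp add: distr(2) vimage_def Int_def conj_commute)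
  have meas: "{\<omega> \<in> space M. ?Y \<omega> \<in> B} \<in> sets M" for B
    using measurable_sets[OF distr(1), of B] by (simp add: vimage_def Int_def conj_commute)
  have wK: "weighted_sum Y K \<omega> = weight K (?Y \<omega>)" for \<omega>
    using assms(8) by (auto simp: weighted_sum_def intro!: sum.cong)
  have wI: "weighted_sum Y ?I \<omega> = weight ?I (?Y \<omega>)" for \<omega>
    by (auto simp: weighted_sum_def intro!: sum.cong)
  have pos: "measure ?p ?A > 0"
    using assms(7) prob[of ?A] by (simp add: wI)
  then have ne: "set_pmf ?p \<inter> ?A \<noteq> {}"
    using measure_pmf_zero_iff[of ?p ?A] by auto

  have "\<exists>C :: real. \<forall>f. weight ?I f = n \<longrightarrow> pmf ?p f = C * card (fibre c m n f)"
    using assms(2,3) by (rule pmf_refined_law)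
  then obtain C :: real where C: "\<forall>f. weight ?I f = n \<longrightarrow> pmf ?p f = C * card (fibre c m n f)" ..
  have C: "pmf ?p f = C * card (fibre c m n f)" if "f \<in> ?A" for f
    using C that by simp
  \<comment> \<open>The conditioning relation: the component counts of a uniform structure have the
    law of the independent process given \<open>T = n\<close>.\<close>
  have cond: "cond_pmf ?p ?A = map_pmf (component_counts m n) (pmf_of_set ?S)"
    by (rule cond_pmf_eq_map_pmf_of_set[OF finite_comb_objects ne _ C])
       (simp add: weight_component_counts)

  have D: "\<P>(s in measure_pmf (pmf_of_set ?S). (\<lambda>\<alpha>\<in>K. component_count s \<alpha>) = u) =
    pmf (map_pmf ?r (cond_pmf ?p ?A)) u" for u
  proof -
    have "?r (component_counts m n s) = (\<lambda>\<alpha>\<in>K. component_count s \<alpha>)" for s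
      using assms(8) by (simp add: component_counts_def Int_absorb1)
    then show ?thesis
      unfolding cond by (simp add: map_pmf_comp pmf_map vimage_def)
  qed
  have Y: "\<P>(\<omega> in M. (\<lambda>\<alpha>\<in>K. Y \<alpha> \<omega>) = u) = pmf (map_pmf ?r ?p) u" for u
  proof -
    have "?r (?Y \<omega>) = (\<lambda>\<alpha>\<in>K. Y \<alpha> \<omega>)" for \<omega>
      using assms(8) by (simp add: Int_absorb1)
    then show ?thesis
      using prob[of "?r -` {u}"] by (simp add: pmf_map)
  qed
  have R: "\<P>(\<omega> in M. weighted_sum Y K \<omega> = r) = pmf (map_pmf (weight K) ?p) r" for r
    using prob[of "weight K -` {r}"] by (simp add: pmf_map wK)
  have RT: "\<P>(\<omega> in conditioned M (\<lambda>\<omega>. weighted_sum Y ?I \<omega> = n). weighted_sum Y K \<omega> = r) =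
    pmf (map_pmf (weight K) (cond_pmf ?p ?A)) r" for r
  proof -
    let ?T = "{\<omega> \<in> space M. weighted_sum Y ?I \<omega> = n}"
    let ?R = "{\<omega> \<in> space M. weighted_sum Y K \<omega> = r}"
    have T: "?T = {\<omega> \<in> space M. ?Y \<omega> \<in> ?A}" and R: "?R = {\<omega> \<in> space M. ?Y \<omega> \<in> weight K -` {r}}"
      by (auto simp: wI wK)
    have TR: "?T \<inter> ?R = {\<omega> \<in> space M. ?Y \<omega> \<in> ?A \<inter> weight K -` {r}}"
      unfolding T R by auto
    have "emeasure M ?T \<noteq> 0"
      using assms(7) by (simp add: emeasure_eq_measure)
    \<comment> \<open>\<open>uniform_measure\<close> and \<open>cond_pmf\<close> both divide the
      mass of the intersection by that of the condition, so conditioning commutes with passing to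
      pmfs.\<close>
    then have "measure (uniform_measure M ?T) ?R = measure M (?T \<inter> ?R) / measure M ?T"
      using meas[of "weight K -` {r}"] unfolding R[symmetric]
      by (intro measure_uniform_measure) auto
    also have "\<dots> = measure ?p (?A \<inter> weight K -` {r}) / measure ?p ?A"
      unfolding TR by (simp only: T prob)
    also have "\<dots> = pmf (map_pmf (weight K) (cond_pmf ?p ?A)) r"
      using pos by (simp add: pmf_map cond_pmf.rep_eq[OF ne] measure_pmf.emeasure_eq_measure)
    finally show ?thesis
      by simp
  qed

  obtain g where g: "\<And>u. pmf (map_pmf ?r (cond_pmf ?p ?A)) u = pmf (map_pmf ?r ?p) u * g (weight K u)"
    using pmf_restrict_cond_weight[OF finite_refined_index assms(8) ne] by blast
  \<comment> \<open>\<open>weight K\<close> reads only coordinates in \<open>K\<close>, so the image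
    of the restricted law under this statistic is the law of the weighted sum itself.\<close>
  have "map_pmf (weight K) (map_pmf ?r q) = map_pmf (weight K) q" for q
    by (simp add: map_pmf_comp)
  then show ?thesis
    unfolding d_TV_def D Y R RT using infsum_abs_pmf_diff_sufficient[where t = "weight K" and g = g, OF g] by simp
qed

end
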